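(* Let $(\Phi,\mathfrak N,\mathfrak T,\mathfrak R,\mathfrak S,\phi_{\mathrm{start}},\Sigma,\mathrm{Lex},\mathrm{Sel})$ be a parameterized local lexing, $D\in\Sigma^*$, and suppose $(N^\alpha_\beta\to w)\in\overline{\mathfrak R}$ with $N\in\mathfrak N$. If $w$ ends with $\bot$ then $|w|\ge2$. Furthermore, for every $d$ with $0\le d\le|w|$ if $w$ does not end with $\bot$, and $0\le d\le|w|-2$ if $w$ ends with $\bot$, and for all $0\le i\le j\le|D|$, there is a parameterized item $x=(r,d,i,j,\rho)$ whose rule $r$ has left-hand side $N$ such that $(N^\alpha_\beta\to w,d,i,j)\in\overline x$.
   Context: $\Phi$ is a non-empty set; $\mathfrak N,\mathfrak T$ disjoint sets of nonterminals and terminals; $\mathfrak S\in\mathfrak N$, $\phi_{\mathrm{start}}\in\Phi$; $\mathfrak R$ a set of parameterized rules $N_{f_{k+1}}\to X_1^{f_1}\cdots X_k^{f_k}$ ($k\ge0$, $N\in\mathfrak N$, $X_i\in\mathfrak N\cup\mathfrak T$, partial $f_i:\Phi^{2i-1}\rightharpoonup\Phi$); $\Sigma,\mathrm{Lex},\mathrm{Sel}$ not needed here. Sequences indexed from 0; $\mathrm{take}_n$ takes the first $n$ entries. $\langle f_1,\dots,f_u\rangle$ is the set of $\rho\in\Phi^{2u}$ with $f_i$ defined at $(\rho_0,\dots,\rho_{2i-2})$ and $\rho_{2i-1}=f_i(\rho_0,\dots,\rho_{2i-2})$ for $i=1,\dots,u$. Induced grammar: nonterminals $(\mathfrak N\times\Phi\times\Phi)\cup\{\top,\bot\}$,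 terminals $\mathfrak T\times\Phi\times\Phi$, triples written $X^\alpha_\beta$; rules $\overline{\mathfrak R}=\{\top\to\mathfrak S^{\phi_{\mathrm{start}}}_\beta\mid\beta\in\Phi\}\cup\bigcup_{r\in\mathfrak R}\overline r$, where for $r=N_{f_{k+1}}\to X_1^{f_1}\cdots X_k^{f_k}$, $\overline r$ consists of (i) rules $N^\alpha_\beta\to(X_1)^{\alpha_1}_{\beta_1}\cdots(X_k)^{\alpha_k}_{\beta_k}$ with $(\alpha,\alpha_1,\beta_1,\dots,\alpha_k,\beta_k,\beta)\in\langle f_1,\dots,f_{k+1}\rangle$, and (ii) rules $N^\alpha_\beta\to(X_1)^{\alpha_1}_{\beta_1}\cdots(X_h)^{\alpha_h}_{\beta_h}\bot$ with $1\le h\le k$, $\beta,\beta_h\in\Phi$, $(\alpha,\alpha_1,\beta_1,\dots,\alpha_h)\in\langle f_1,\dots,f_h\rangle$ and $f_{h+1}$ undefined at $(\alpha,\alpha_1,\beta_1,\dots,\alpha_h,\beta_h)$. A parameterized item is $(r,d,i,j,\rho)$ with $r\in\mathfrak R$ having $k$ right-hand symbols, $0\le d\le k$, $0\le i\le j\le|D|$, $\rho\in\langle f_1,\dots,f_{d+1}\rangle$. An ordinary item is $(q,d,i,j)$ with $q=(L\to w)\in\overline{\mathfrak R}$, $0\le d\le|w|$, $0\le i\le j\le|D|$. For $x=(r,d,i,j,\rho)$, $\overline x$ consists of all $(q,d,i,j)$ with $q\in\overline r$ of type (i) and $\mathrm{take}_{2(d+1)}(\alpha,\alpha_1,\beta_1,\dots,\alpha_k,\beta_k,\beta)=\rho$,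 and all $(q,d,i,j)$ with $q\in\overline r$ of type (ii), $d\le h-1$, and $\mathrm{take}_{2(d+1)}(\alpha,\alpha_1,\beta_1,\dots,\alpha_h)=\rho$. *)

theory Defs
  imports Main
begin

text \<open>
  The parameterized rule with left-hand side \<open>N\<close>, right-hand side \<open>X\<^sub>1 \<dots> X\<^sub>k\<close> and partial functions
  \<open>f\<^sub>1, \<dots>, f\<^sub>k, f\<^sub>k\<^sub>+\<^sub>1\<close> is \<open>PRule N f\<^sub>k\<^sub>+\<^sub>1 [(X\<^sub>1, f\<^sub>1), \<dots>, (X\<^sub>k, f\<^sub>k)]\<close>. A partial function from
  \<open>\<Phi>\<^sup>n\<close> to \<open>\<Phi>\<close> is a map on lists, equal to \<open>None\<close> outside \<open>\<Phi>\<^sup>n\<close>.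
\<close>

type_synonym 'p pfun = "'p list \<Rightarrow> 'p option"

datatype ('s, 'p) prule =
  PRule (lhs: 's) (lhs_fun: "'p pfun") (rhs: "('s \<times> 'p pfun) list")

definition rule_funs :: "('s, 'p) prule \<Rightarrow> 'p pfun list" where
  "rule_funs r = map snd (rhs r) @ [lhs_fun r]"

definition partial_fun :: "'p set \<Rightarrow> nat \<Rightarrow> 'p pfun \<Rightarrow> bool" where
  "partial_fun \<Phi> n f \<longleftrightarrow>
     (\<forall>\<sigma> \<phi>. f \<sigma> = Some \<phi> \<longrightarrow> length \<sigma> = n \<and> set \<sigma> \<subseteq> \<Phi> \<and> \<phi> \<in> \<Phi>)"

definition wf_prule :: "'p set \<Rightarrow> 's set \<Rightarrow> 's set \<Rightarrow> ('s, 'p) prule \<Rightarrow> bool" where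
  "wf_prule \<Phi> \<NN> \<TT> r \<longleftrightarrow>
     lhs r \<in> \<NN> \<and> fst ` set (rhs r) \<subseteq> \<NN> \<union> \<TT> \<and>
     (\<forall>i \<in> {1..length (rule_funs r)}. partial_fun \<Phi> (2 * i - 1) (rule_funs r ! (i - 1)))"

text \<open>
  The character set, lexer and selector of a parameterized local lexing are left out: the induced
  grammar does not depend on them, and the items depend only on the length of the input.
\<close>

locale parameterized_local_lexing =
  fixes \<Phi> :: "'p set"
    and \<NN> \<TT> :: "'s set"
    and \<RR> :: "('s, 'p) prule set"
    and \<SS> :: 's
    and \<phi>_start :: 'p
  assumes params_nonempty: "\<Phi> \<noteq> {}"
    and disjoint: "\<NN> \<inter> \<TT> = {}"
    and start_nonterminal: "\<SS> \<in> \<NN>"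
    and start_param: "\<phi>_start \<in> \<Phi>"
    and wf_rules: "\<And>r. r \<in> \<RR> \<Longrightarrow> wf_prule \<Phi> \<NN> \<TT> r"

text \<open>\<open>traces \<Phi> [f\<^sub>1, \<dots>, f\<^sub>u]\<close> is \<open>\<langle>f\<^sub>1, \<dots>, f\<^sub>u\<rangle>\<close>.\<close>

definition traces :: "'p set \<Rightarrow> 'p pfun list \<Rightarrow> 'p list set" where
  "traces \<Phi> fs = {\<rho>. length \<rho> = 2 * length fs \<and> set \<rho> \<subseteq> \<Phi> \<and>
     (\<forall>i \<in> {1..length fs}. (fs ! (i - 1)) (take (2 * i - 1) \<rho>) = Some (\<rho> ! (2 * i - 1)))}"

datatype ('s, 'p) isym = Sym 's 'p 'p | Top | Bot

type_synonym ('s, 'p) irule = "('s, 'p) isym \<times> ('s, 'p) isym list"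

text \<open>\<open>param_seq \<alpha> [(\<alpha>\<^sub>1, \<beta>\<^sub>1), \<dots>, (\<alpha>\<^sub>h, \<beta>\<^sub>h)] = [\<alpha>, \<alpha>\<^sub>1, \<beta>\<^sub>1, \<dots>, \<alpha>\<^sub>h, \<beta>\<^sub>h]\<close>\<close>

definition param_seq :: "'p \<Rightarrow> ('p \<times> 'p) list \<Rightarrow> 'p list" where
  "param_seq \<alpha> ps = \<alpha> # concat (map (\<lambda>(a, b). [a, b]) ps)"

definition annotate :: "('s, 'p) prule \<Rightarrow> ('p \<times> 'p) list \<Rightarrow> ('s, 'p) isym list" where
  "annotate r ps = map2 (\<lambda>X (a, b). Sym X a b) (take (length ps) (map fst (rhs r))) ps"

text \<open>
  An induced rule of type (i) is given by \<open>\<alpha>\<close>, the pairs \<open>(\<alpha>\<^sub>1, \<beta>\<^sub>1), \<dots>, (\<alpha>\<^sub>k, \<beta>\<^sub>k)\<close> and \<open>\<beta>\<close>.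
  One of type (ii) is given by \<open>\<alpha>\<close>, the first \<open>h\<close> pairs and \<open>\<beta>\<close>; there \<open>butlast\<close> drops the
  unconstrained parameter \<open>\<beta>\<^sub>h\<close>, and \<open>rule_funs r ! h\<close> is \<open>f\<^sub>h\<^sub>+\<^sub>1\<close>.
\<close>

definition instances_i :: "'p set \<Rightarrow> ('s, 'p) prule \<Rightarrow> ('p \<times> ('p \<times> 'p) list \<times> 'p) set" where
  "instances_i \<Phi> r = {(\<alpha>, ps, \<beta>).
     length ps = length (rhs r) \<and> param_seq \<alpha> ps @ [\<beta>] \<in> traces \<Phi> (rule_funs r)}"

definition instances_ii :: "'p set \<Rightarrow> ('s, 'p) prule \<Rightarrow> ('p \<times> ('p \<times> 'p) list \<times> 'p) set" where
  "instances_ii \<Phi> r = {(\<alpha>, ps, \<beta>). \<exists>h.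
     length ps = h \<and> 1 \<le> h \<and> h \<le> length (rhs r) \<and> \<beta> \<in> \<Phi> \<and> snd (last ps) \<in> \<Phi> \<and>
     butlast (param_seq \<alpha> ps) \<in> traces \<Phi> (take h (rule_funs r)) \<and>
     (rule_funs r ! h) (param_seq \<alpha> ps) = None}"

definition rule_i :: "('s, 'p) prule \<Rightarrow> 'p \<Rightarrow> ('p \<times> 'p) list \<Rightarrow> 'p \<Rightarrow> ('s, 'p) irule" where
  "rule_i r \<alpha> ps \<beta> = (Sym (lhs r) \<alpha> \<beta>, annotate r ps)"

definition rule_ii :: "('s, 'p) prule \<Rightarrow> 'p \<Rightarrow> ('p \<times> 'p) list \<Rightarrow> 'p \<Rightarrow> ('s, 'p) irule" where
  "rule_ii r \<alpha> ps \<beta> = (Sym (lhs r) \<alpha> \<beta>, annotate r ps @ [Bot])"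

definition induced_by :: "'p set \<Rightarrow> ('s, 'p) prule \<Rightarrow> ('s, 'p) irule set" where
  "induced_by \<Phi> r =
     {rule_i r \<alpha> ps \<beta> | \<alpha> ps \<beta>. (\<alpha>, ps, \<beta>) \<in> instances_i \<Phi> r} \<union>
     {rule_ii r \<alpha> ps \<beta> | \<alpha> ps \<beta>. (\<alpha>, ps, \<beta>) \<in> instances_ii \<Phi> r}"

definition induced_rules ::
  "'p set \<Rightarrow> ('s, 'p) prule set \<Rightarrow> 's \<Rightarrow> 'p \<Rightarrow> ('s, 'p) irule set" where
  "induced_rules \<Phi> \<RR> \<SS> \<phi>_start =
     {(Top, [Sym \<SS> \<phi>_start \<beta>]) | \<beta>. \<beta> \<in> \<Phi>} \<union> (\<Union>r \<in> \<RR>. induced_by \<Phi> r)"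

type_synonym ('s, 'p) pitem = "('s, 'p) prule \<times> nat \<times> nat \<times> nat \<times> 'p list"
type_synonym ('s, 'p) item = "('s, 'p) irule \<times> nat \<times> nat \<times> nat"

definition pitems :: "'p set \<Rightarrow> ('s, 'p) prule set \<Rightarrow> 'c list \<Rightarrow> ('s, 'p) pitem set" where
  "pitems \<Phi> \<RR> D = {(r, d, i, j, \<rho>).
     r \<in> \<RR> \<and> d \<le> length (rhs r) \<and> i \<le> j \<and> j \<le> length D \<and>
     \<rho> \<in> traces \<Phi> (take (d + 1) (rule_funs r))}"

text \<open>\<open>expand \<Phi> x\<close> is the set of ordinary items \<open>x\<close> stands for. The bound \<open>d \<le> h - 1\<close> for
  type (ii) is \<open>d < length ps\<close>.\<close>

fun expand :: "'p set \<Rightarrow> ('s, 'p) pitem \<Rightarrow> ('s, 'p) item set" where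
  "expand \<Phi> (r, d, i, j, \<rho>) =
     {(rule_i r \<alpha> ps \<beta>, d, i, j) | \<alpha> ps \<beta>. (\<alpha>, ps, \<beta>) \<in> instances_i \<Phi> r \<and>
        take (2 * (d + 1)) (param_seq \<alpha> ps @ [\<beta>]) = \<rho>} \<union>
     {(rule_ii r \<alpha> ps \<beta>, d, i, j) | \<alpha> ps \<beta>. (\<alpha>, ps, \<beta>) \<in> instances_ii \<Phi> r \<and>
        d < length ps \<and> take (2 * (d + 1)) (butlast (param_seq \<alpha> ps)) = \<rho>}"

definition ends_with_bot :: "('s, 'p) isym list \<Rightarrow> bool" where
  "ends_with_bot w \<longleftrightarrow> (\<exists>u. w = u @ [Bot])"

end

theory Submission
  imports Defs
begin

text \<open>A rule whose left-hand side is a \<open>Sym\<close> is an instance of some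
  \<open>r\<close>, of type (i) or (ii), and the instance comes with a trace: a run of parameters
  computed by the functions of \<open>r\<close>. Cutting that trace to length
  \<open>2 * (d + 1)\<close> gives the \<rho> of the wanted item, since a prefix of a trace is a
  trace for the corresponding prefix of the functions (\<open>traces_take\<close>). The trace of a
  type (i) instance covers all functions, so any dot position is allowed. That of a type (ii)
  instance stops after the first \<open>h\<close>, which forces \<open>d < h\<close>. As
  \<open>w\<close> then consists of \<open>h\<close> symbols and \<open>Bot\<close>, with
  \<open>h \<ge> 1\<close>, this is the bound \<open>d + 2 \<le> length w\<close>, and
  \<open>length w \<ge> 2\<close>.\<close>

lemma traces_take:
  assumes "\<rho> \<in> traces \<Phi> fs"
  shows "take (2 * n) \<rho> \<in> traces \<Phi> (take n fs)"
proof -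
  have len: "length \<rho> = 2 * length fs"
    and sub: "set \<rho> \<subseteq> \<Phi>"
    and val: "\<And>i. 1 \<le> i \<Longrightarrow> i \<le> length fs \<Longrightarrow>
      (fs ! (i - 1)) (take (2 * i - 1) \<rho>) = Some (\<rho> ! (2 * i - 1))"
    using assms by (auto simp: traces_def)
  have "(take n fs ! (i - 1)) (take (2 * i - 1) (take (2 * n) \<rho>))
      = Some (take (2 * n) \<rho> ! (2 * i - 1))"
    if "1 \<le> i" "i \<le> length fs" "i \<le> n" for i
  proof -
    \<comment> \<open>For \<open>i \<le> n\<close> the arguments of the \<open>i\<close>-th function
      and the position of its value all lie in the part that is kept.\<close>
    have "min (2 * i - 1) (2 * n) = 2 * i - 1"
      using that by simp
    then show ?thesis
      using that val[of i] by (simp add: take_take)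
  qed
  moreover have "set (take (2 * n) \<rho>) \<subseteq> \<Phi>"
    using sub set_take_subset by fast
  ultimately show ?thesis
    using len by (auto simp: traces_def)
qed

lemma length_annotate:
  "length ps \<le> length (rhs r) \<Longrightarrow> length (annotate r ps) = length ps"
  by (simp add: annotate_def)

lemma Bot_notin_annotate: "Bot \<notin> set (annotate r ps)"
  by (auto simp: annotate_def)

text \<open>Annotated symbols are all of the form \<open>Sym\<close>, so a final \<open>Bot\<close>
  tells type (ii) from type (i).\<close>

lemma not_ends_with_bot_annotate: "\<not> ends_with_bot (annotate r ps)"
  using Bot_notin_annotate[of r ps] by (auto simp: ends_with_bot_def)

lemma ends_with_bot_snoc: "ends_with_bot (u @ [Bot])"
  by (simp add: ends_with_bot_def)

lemma pitem_of_rule_i: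
  assumes "r \<in> \<RR>" and inst: "(\<alpha>, ps, \<beta>) \<in> instances_i \<Phi> r"
    and "d \<le> length ps" "i \<le> j" "j \<le> length D"
  shows "\<exists>\<rho>. (r, d, i, j, \<rho>) \<in> pitems \<Phi> \<RR> D \<and>
    (rule_i r \<alpha> ps \<beta>, d, i, j) \<in> expand \<Phi> (r, d, i, j, \<rho>)"
proof -
  \<comment> \<open>The choice is dictated by the type (i) part of \<open>expand\<close>.\<close>
  define \<rho> where "\<rho> = take (2 * (d + 1)) (param_seq \<alpha> ps @ [\<beta>])"
  have "\<rho> \<in> traces \<Phi> (take (d + 1) (rule_funs r))"
    using inst unfolding \<rho>_def instances_i_def by (blast intro: traces_take)
  moreover have "length ps = length (rhs r)"
    using inst by (simp add: instances_i_def)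
  ultimately have "(r, d, i, j, \<rho>) \<in> pitems \<Phi> \<RR> D"
    using assms by (simp add: pitems_def)
  moreover have "(rule_i r \<alpha> ps \<beta>, d, i, j) \<in> expand \<Phi> (r, d, i, j, \<rho>)"
    using inst unfolding \<rho>_def expand.simps by blast
  ultimately show ?thesis by blast
qed

lemma pitem_of_rule_ii:
  assumes "r \<in> \<RR>" and inst: "(\<alpha>, ps, \<beta>) \<in> instances_ii \<Phi> r"
    and "d < length ps" "i \<le> j" "j \<le> length D"
  shows "\<exists>\<rho>. (r, d, i, j, \<rho>) \<in> pitems \<Phi> \<RR> D \<and>
    (rule_ii r \<alpha> ps \<beta>, d, i, j) \<in> expand \<Phi> (r, d, i, j, \<rho>)"
proof -
  define \<rho> where "\<rho> = take (2 * (d + 1)) (butlast (param_seq \<alpha> ps))"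
  have "\<rho> \<in> traces \<Phi> (take (d + 1) (take (length ps) (rule_funs r)))"
    using inst unfolding \<rho>_def instances_ii_def by (blast intro: traces_take)
  \<comment> \<open>Here \<open>d < length ps\<close> is essential: the trace must contain values
    for the first \<open>d + 1\<close> functions.\<close>
  moreover have "take (d + 1) (take (length ps) (rule_funs r)) = take (d + 1) (rule_funs r)"
    using assms by (simp add: take_take)
  moreover have "length ps \<le> length (rhs r)"
    using inst by (auto simp: instances_ii_def)
  ultimately have "(r, d, i, j, \<rho>) \<in> pitems \<Phi> \<RR> D"
    using assms by (simp add: pitems_def)
  moreover have "(rule_ii r \<alpha> ps \<beta>, d, i, j) \<in> expand \<Phi> (r, d, i, j, \<rho>)"
    using inst assms(3) unfolding \<rho>_def expand.simps by blast
  ultimately show ?thesis by blast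
qed

theorem theorem5:
  fixes \<Phi> :: "'p set" and \<NN> \<TT> :: "'s set" and \<RR> :: "('s, 'p) prule set"
    and \<SS> N :: 's and \<phi>_start \<alpha> \<beta> :: 'p and \<Sigma> :: "'c set" and D :: "'c list"
    and w :: "('s, 'p) isym list"
  assumes "parameterized_local_lexing \<Phi> \<NN> \<TT> \<RR> \<SS> \<phi>_start"
    and "D \<in> lists \<Sigma>"
    and "N \<in> \<NN>"
    and "(Sym N \<alpha> \<beta>, w) \<in> induced_rules \<Phi> \<RR> \<SS> \<phi>_start"
  shows "(ends_with_bot w \<longrightarrow> length w \<ge> 2) \<and>
    (\<forall>d i j. (if ends_with_bot w then d + 2 \<le> length w else d \<le> length w) \<and>
       i \<le> j \<and> j \<le> length D \<longrightarrow>
       (\<exists>r \<rho>. (r, d, i, j, \<rho>) \<in> pitems \<Phi> \<RR> D \<and> lhs r = N \<and>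
          ((Sym N \<alpha> \<beta>, w), d, i, j) \<in> expand \<Phi> (r, d, i, j, \<rho>)))"
proof -
  \<comment> \<open>The start rules are excluded because their left-hand side is
    \<open>Top\<close>.\<close>
  obtain r where r: "r \<in> \<RR>" and "(Sym N \<alpha> \<beta>, w) \<in> induced_by \<Phi> r"
    using assms(4) by (auto simp: induced_rules_def)
  then consider
      (i) \<alpha>' ps \<beta>' where "(\<alpha>', ps, \<beta>') \<in> instances_i \<Phi> r" "(Sym N \<alpha> \<beta>, w) = rule_i r \<alpha>' ps \<beta>'"
    | (ii) \<alpha>' ps \<beta>' where "(\<alpha>', ps, \<beta>') \<in> instances_ii \<Phi> r" "(Sym N \<alpha> \<beta>, w) = rule_ii r \<alpha>' ps \<beta>'"
    unfolding induced_by_def by blast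
  then show ?thesis
  proof cases
    case i
    have "length ps = length (rhs r)"
      using i(1) by (simp add: instances_i_def)
    then have "length w = length ps" "\<not> ends_with_bot w" "lhs r = N"
      using i(2) by (auto simp: rule_i_def length_annotate not_ends_with_bot_annotate)
    then show ?thesis
      using pitem_of_rule_i[OF r i(1)] unfolding i(2) by (simp del: expand.simps) blast
  next
    case ii
    have "1 \<le> length ps" "length ps \<le> length (rhs r)"
      using ii(1) by (auto simp: instances_ii_def)
    \<comment> \<open>The extra symbol is the final \<open>Bot\<close>; hence
      \<open>d + 2 \<le> length w\<close> says exactly \<open>d < length ps\<close>.\<close>
    moreover from this have "length w = length ps + 1" "ends_with_bot w" "lhs r = N"
      using ii(2) by (auto simp: rule_ii_def length_annotate ends_with_bot_snoc)
    ultimately show ?thesis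
      using pitem_of_rule_ii[OF r ii(1)] unfolding ii(2) by (simp del: expand.simps add: Suc_le_eq) blast
  qed
qed

end
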